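(* Let $\frac{1}{2}<c\leq 1$ be a constant and let $\mathcal{H}$ be a class of graphs. Then $ex(n,\mathcal{H})=O(n^{1+c})$ if and only if $spex(n,\mathcal{H})=O(n^{c})$ (as $n\to\infty$). Moreover, if $ex(n,\mathcal{H})=\Theta(n^{1+c})$, then $spex(n,\mathcal{H})=\Theta(n^{c})$.
   Context: All graphs are finite and simple. For a class of graphs $\mathcal{H}$, a graph $G$ is $\mathcal{H}$-free if it contains no (not necessarily induced) subgraph isomorphic to a member of $\mathcal{H}$. The Turán number $ex(n,\mathcal{H})$ is the maximum number of edges of an $n$-vertex $\mathcal{H}$-free graph, and the spectral Turán number $spex(n,\mathcal{H})$ is the maximum spectral radius (largest eigenvalue of the adjacency matrix) of an $n$-vertex $\mathcal{H}$-free graph. *)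

theory Defs
  imports Jordan_Normal_Form.Char_Poly "HOL-Library.Landau_Symbols"
begin

datatype 'a graph = Graph (verts: "'a set") (edges: "'a set set")

definition simple_graph :: "'a graph \<Rightarrow> bool" where
  "simple_graph G \<longleftrightarrow> finite (verts G) \<and> (\<forall>e\<in>edges G. e \<subseteq> verts G \<and> card e = 2)"

definition subgraph :: "'a graph \<Rightarrow> 'a graph \<Rightarrow> bool" where
  "subgraph S G \<longleftrightarrow> simple_graph S \<and> verts S \<subseteq> verts G \<and> edges S \<subseteq> edges G"

definition isomorphic :: "'a graph \<Rightarrow> 'b graph \<Rightarrow> bool" where
  "isomorphic G H \<longleftrightarrow>
    (\<exists>f. bij_betw f (verts G) (verts H) \<and>
         (\<forall>u\<in>verts G. \<forall>v\<in>verts G. {u, v} \<in> edges G \<longleftrightarrow> {f u, f v} \<in> edges H))"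

definition free_of :: "'b graph set \<Rightarrow> 'a graph \<Rightarrow> bool" where
  "free_of \<H> G \<longleftrightarrow> \<not> (\<exists>H\<in>\<H>. \<exists>S. subgraph S G \<and> isomorphic S H)"

text \<open>Every graph on \<open>n\<close> vertices is isomorphic to one with vertex set \<open>{0,\<dots>,n-1}\<close>, and the
  number of edges, the spectrum and freeness are isomorphism invariants, so only the latter
  graphs are considered.\<close>

definition free_graphs :: "nat \<Rightarrow> 'b graph set \<Rightarrow> nat graph set" where
  "free_graphs n \<H> = {G. simple_graph G \<and> verts G = {..<n} \<and> free_of \<H> G}"

definition adjacency_matrix :: "nat \<Rightarrow> nat graph \<Rightarrow> real mat" where
  "adjacency_matrix n G = mat n n (\<lambda>(i, j). if {i, j} \<in> edges G then 1 else 0)"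

text \<open>For \<open>n > 0\<close> the spectrum is finite and, the matrix being symmetric, nonempty;
  for \<open>n = 0\<close> there are no eigenvalues and the value is unspecified.\<close>

definition graph_spectral_radius :: "nat \<Rightarrow> nat graph \<Rightarrow> real" where
  "graph_spectral_radius n G = Max {k. eigenvalue (adjacency_matrix n G) k}"

text \<open>If \<open>\<H>\<close> has an edgeless member, there is no \<open>\<H>\<close>-free graph on \<open>n\<close> vertices for large \<open>n\<close>;
  both extremal numbers are then \<open>0\<close> by convention.\<close>

definition turan_number :: "nat \<Rightarrow> 'b graph set \<Rightarrow> nat" where
  "turan_number n \<H> =
    (if free_graphs n \<H> = {} then 0 else Max ((\<lambda>G. card (edges G)) ` free_graphs n \<H>))"

definition spectral_turan_number :: "nat \<Rightarrow> 'b graph set \<Rightarrow> real" where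
  "spectral_turan_number n \<H> =
    (if free_graphs n \<H> = {} then 0 else Max (graph_spectral_radius n ` free_graphs n \<H>))"

end

theory Submission
  imports Defs "HOL-Analysis.Function_Topology" "HOL-Analysis.Convex"
begin

text \<open>
  One direction compares the largest eigenvalue with the Rayleigh quotient of the all-ones vector,
  which is the average degree. For the other, freeness passes to induced subgraphs, so if
  \<open>ex(m,\<H>) \<le> C m\<^sup>1\<^sup>+\<^sup>c\<close> for all \<open>m\<close>, every vertex set \<open>S\<close> of an \<open>\<H>\<close>-free graph spans at
  most \<open>C |S|\<^sup>1\<^sup>+\<^sup>c\<close> edges. Cutting the larger of two vertex sets into blocks of the size of the smaller
  one bounds the number of adjacent pairs in \<open>A \<times> B\<close> by \<open>O(|A|\<^sup>c |B|)\<close> for \<open>|A| \<le> |B|\<close>. Now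
  sort a nonnegative vector \<open>x\<close> decreasingly and decompose it into its superlevel sets, which are the
  initial segments: summation by parts bounds the quadratic form of the adjacency matrix by a multiple of
  \<open>(\<Sum>x\<^sub>i (i\<^sup>c - (i-1)\<^sup>c)) (\<Sum>x\<^sub>i)\<close>, hence by \<open>(\<Sum>x\<^sub>i i\<^sup>c\<^sup>-\<^sup>1) (\<Sum>x\<^sub>i)\<close>. By Cauchy-Schwarz this is at most
  \<open>O(n\<^sup>c\<^sup>-\<^sup>1\<^sup>/\<^sup>2) \<cdot> n\<^sup>1\<^sup>/\<^sup>2\<close> times the squared norm of \<open>x\<close>; the first factor is where \<open>c > 1/2\<close> is needed.
\<close>

section \<open>The largest eigenvalue\<close>

text \<open>The part of the spectral theorem that is needed: the maximum of the Rayleigh quotient is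
  attained, by compactness of the unit sphere, and a maximiser is an eigenvector.\<close>

lemma symmetric_form_max:
  fixes a :: "nat \<Rightarrow> nat \<Rightarrow> real"
  assumes n: "0 < n" and sym: "\<And>i j. a i j = a j i"
  obtains x M where "\<exists>i<n. x i \<noteq> 0" "\<And>i. i < n \<Longrightarrow> (\<Sum>j<n. a i j * x j) = M * x i"
    "\<And>y. (\<Sum>i<n. \<Sum>j<n. a i j * y i * y j) \<le> M * (\<Sum>i<n. (y i)\<^sup>2)"
proof -
  define q where "q y z = (\<Sum>i<n. \<Sum>j<n. a i j * y i * z j)" for y z :: "nat \<Rightarrow> real"
  define s where "s y = (\<Sum>i<n. (y i)\<^sup>2)" for y :: "nat \<Rightarrow> real"
  define K :: "(nat \<Rightarrow> real) set" where "K = {y. (\<forall>i\<in>{n..}. y i = 0) \<and> s y = 1}"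
  \<comment> \<open>Tychonoff for a cube in \<open>nat \<Rightarrow> real\<close>. In
    \<open>K\<close> the coordinates from \<open>n\<close> on are frozen at 0, so \<open>K\<close>
    is the unit sphere of dimension \<open>n\<close> sitting inside this cube.\<close>
  have "compact (PiE UNIV (\<lambda>_::nat. {-1..1::real}))"
    using compactin_PiE[of "\<lambda>_. euclidean" UNIV "\<lambda>_::nat. {-1..1::real}"]
    by (simp add: euclidean_product_topology)
  moreover have "closed K"
    unfolding K_def s_def Ball_def
    by (intro closed_Collect_conj closed_Collect_all closed_Collect_imp closed_Collect_eq
        continuous_intros continuous_on_product_coordinates) auto
  moreover have "K \<subseteq> PiE UNIV (\<lambda>_. {-1..1})"
  proof
    fix y assume y: "y \<in> K"
    have "\<bar>y i\<bar> \<le> 1" for i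
    proof (cases "i < n")
      case True
      then have "(y i)\<^sup>2 \<le> s y"
        unfolding s_def by (intro member_le_sum) auto
      then show ?thesis using y by (simp add: K_def abs_square_le_1)
    qed (use y in \<open>auto simp: K_def\<close>)
    then show "y \<in> PiE UNIV (\<lambda>_. {-1..1})" by (auto simp: abs_le_iff minus_le_iff)
  qed
  ultimately have "compact K" by (metis compact_Int_closed inf.absorb_iff2)
  moreover have "(\<lambda>i. if i = 0 then 1 else 0) \<in> K"
    using n by (auto simp: K_def s_def if_distrib[of "\<lambda>x. x\<^sup>2"] cong: if_cong)
  moreover have "continuous_on K (\<lambda>y. q y y)"
    unfolding q_def
    by (intro continuous_intros continuous_on_subset[OF continuous_on_product_coordinates]) auto
  ultimately obtain x where x: "x \<in> K" and max: "\<And>y. y \<in> K \<Longrightarrow> q y y \<le> q x x"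
    using continuous_attains_sup[of K "\<lambda>y. q y y"] by blast
  define M where "M = q x x"
  \<comment> \<open>Both sides are homogeneous of degree 2, so the bound on the sphere extends to
    every \<open>y\<close>; if \<open>s y = 0\<close>, both vanish.\<close>
  have bound: "q y y \<le> M * s y" for y
  proof (cases "s y = 0")
    case True
    then have "\<forall>i<n. y i = 0" by (auto simp: s_def sum_nonneg_eq_0_iff)
    then show ?thesis using True by (simp add: q_def)
  next
    case False
    define t where "t = sqrt (s y)"
    have "s y \<ge> 0" by (simp add: s_def sum_nonneg)
    with False have t: "t > 0" "t\<^sup>2 = s y" by (auto simp: t_def)
    define z where "z i = (if i < n then y i / t else 0)" for i
    have "s z = (\<Sum>i<n. (y i)\<^sup>2 / t\<^sup>2)"
      unfolding s_def z_def by (intro sum.cong) (auto simp: power_divide)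
    then have "s z = 1" using t False by (simp add: s_def flip: sum_divide_distrib)
    then have zM: "q z z \<le> M" using max[of z] by (auto simp: K_def z_def M_def)
    have "q z z = (\<Sum>i<n. \<Sum>j<n. a i j * y i * y j / t\<^sup>2)"
      unfolding q_def z_def by (intro sum.cong) (auto simp: power2_eq_square)
    then have "q z z = q y y / t\<^sup>2" by (simp add: q_def sum_divide_distrib)
    with zM have "q y y / t\<^sup>2 \<le> M" by simp
    moreover have "0 < t\<^sup>2" using t(1) by (rule zero_less_power)
    ultimately show ?thesis unfolding t(2) by (simp add: pos_divide_le_eq)
  qed
  define r where "r i = (\<Sum>j<n. a i j * x j) - M * x i" for i
  have sx: "s x = 1" using x by (simp add: K_def)
  have rr: "s r = q r x - M * (\<Sum>i<n. r i * x i)"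
  proof -
    have "s r = (\<Sum>i<n. r i * ((\<Sum>j<n. a i j * x j) - M * x i))"
      unfolding s_def power2_eq_square by (simp add: r_def)
    then show ?thesis by (simp add: q_def right_diff_distrib sum_distrib_left sum_subtractf mult_ac)
  qed
  have qsym: "q x r = q r x"
    unfolding q_def by (subst sum.swap) (auto simp: sym mult_ac intro!: sum.cong)
  \<comment> \<open>First variation: moving the maximiser \<open>x\<close> in the direction of the residual \<open>r\<close> cannot
    increase the quotient, which forces \<open>r = 0\<close>.\<close>
  have var: "2 * t * s r \<le> t\<^sup>2 * (M * s r - q r r)" for t
  proof -
    have "q (\<lambda>i. x i + t * r i) (\<lambda>i. x i + t * r i) = q x x + t * q x r + t * q r x + t\<^sup>2 * q r r"
      unfolding q_def by (simp add: algebra_simps sum.distrib sum_distrib_left power2_eq_square)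
    moreover have "s (\<lambda>i. x i + t * r i) = s x + 2 * t * (\<Sum>i<n. r i * x i) + t\<^sup>2 * s r"
      unfolding s_def by (simp add: algebra_simps sum.distrib sum_distrib_left power2_eq_square)
    ultimately have "M + 2 * t * q r x + t\<^sup>2 * q r r
        \<le> M * (1 + 2 * t * (\<Sum>i<n. r i * x i) + t\<^sup>2 * s r)"
      using bound[of "\<lambda>i. x i + t * r i"] qsym sx by (simp add: M_def)
    then show ?thesis unfolding rr by (simp add: algebra_simps)
  qed
  have "s r \<le> 0"
  proof (rule ccontr)
    assume pos: "\<not> s r \<le> 0"
    \<comment> \<open>Take \<open>t = s r / B\<close> in \<open>var\<close>, with \<open>B\<close> a
      positive upper bound for the coefficient of \<open>t^2\<close>: the right side is then at most
      \<open>t * s r\<close>, half of the left side.\<close>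
    define B where "B = \<bar>M * s r - q r r\<bar> + 1"
    have B: "B > 0" "M * s r - q r r \<le> B" by (auto simp: B_def)
    have "2 * (s r / B) * s r \<le> (s r / B)\<^sup>2 * B"
      by (rule order_trans[OF var mult_left_mono[OF B(2) zero_le_power2]])
    moreover have "(s r / B)\<^sup>2 * B = s r / B * s r"
      using B(1) by (simp add: power2_eq_square)
    moreover have "0 < s r / B * s r" using pos B(1) by simp
    ultimately show False by simp
  qed
  then have "s r = 0" by (simp add: s_def sum_nonneg antisym)
  then have "\<forall>i<n. r i = 0" by (auto simp: s_def sum_nonneg_eq_0_iff)
  then have "\<And>i. i < n \<Longrightarrow> (\<Sum>j<n. a i j * x j) = M * x i" by (auto simp: r_def)
  moreover have "\<exists>i<n. x i \<noteq> 0"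
    using sx by (metis (no_types, lifting) lessThan_iff power_zero_numeral s_def sum.neutral zero_neq_one)
  ultimately show thesis using that bound unfolding q_def s_def by blast
qed

section \<open>Eigenvalues of adjacency matrices\<close>

abbreviation adj :: "'a graph \<Rightarrow> 'a \<Rightarrow> 'a \<Rightarrow> real" where
  "adj G i j \<equiv> of_bool ({i, j} \<in> edges G)"

lemma adjacency_matrix_mult_vec:
  assumes "v \<in> carrier_vec n" "i < n"
  shows "(adjacency_matrix n G *\<^sub>v v) $ i = (\<Sum>j<n. adj G i j * v $ j)"
  using assms unfolding adjacency_matrix_def lessThan_atLeast0
  by (auto simp: scalar_prod_def simp del: sum_of_bool_mult_eq sum_mult_of_bool_eq intro!: sum.cong)

text \<open>Trades vectors for functions on \<open>nat\<close>, the form in which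
  \<open>symmetric_form_max\<close> delivers an eigenvector.\<close>

lemma eigenvalue_adjacency_matrix_iff:
  "eigenvalue (adjacency_matrix n G) k \<longleftrightarrow>
    (\<exists>x. (\<exists>i<n. x i \<noteq> 0) \<and> (\<forall>i<n. (\<Sum>j<n. adj G i j * x j) = k * x i))"
proof
  assume "eigenvalue (adjacency_matrix n G) k"
  then obtain v where v: "v \<in> carrier_vec n" "v \<noteq> 0\<^sub>v n"
    "adjacency_matrix n G *\<^sub>v v = k \<cdot>\<^sub>v v"
    by (auto simp: eigenvalue_def eigenvector_def adjacency_matrix_def)
  have "\<exists>i<n. v $ i \<noteq> 0" using v(1,2) by (metis carrier_vecD eq_vecI index_zero_vec)
  moreover have "(\<Sum>j<n. adj G i j * v $ j) = k * v $ i" if "i < n" for i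
    using adjacency_matrix_mult_vec[OF v(1) that, of G] v that by simp
  ultimately show "\<exists>x. (\<exists>i<n. x i \<noteq> 0) \<and> (\<forall>i<n. (\<Sum>j<n. adj G i j * x j) = k * x i)"
    by blast
next
  assume "\<exists>x. (\<exists>i<n. x i \<noteq> 0) \<and> (\<forall>i<n. (\<Sum>j<n. adj G i j * x j) = k * x i)"
  then obtain x where x: "\<exists>i<n. x i \<noteq> 0"
    "\<And>i. i < n \<Longrightarrow> (\<Sum>j<n. adj G i j * x j) = k * x i" by blast
  have "adjacency_matrix n G *\<^sub>v vec n x = k \<cdot>\<^sub>v vec n x"
  proof (rule eq_vecI)
    fix i assume "i < dim_vec (k \<cdot>\<^sub>v vec n x)"
    then show "(adjacency_matrix n G *\<^sub>v vec n x) $ i = (k \<cdot>\<^sub>v vec n x) $ i"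
      using x(2)[of i] by (simp add: adjacency_matrix_mult_vec[of _ n] del: index_mult_mat_vec)
  qed (simp add: adjacency_matrix_def)
  moreover have "vec n x \<noteq> 0\<^sub>v n" using x(1) by (metis index_vec index_zero_vec(1))
  ultimately have "eigenvector (adjacency_matrix n G) (vec n x) k"
    by (simp add: eigenvector_def adjacency_matrix_def)
  then show "eigenvalue (adjacency_matrix n G) k" by (auto simp: eigenvalue_def)
qed

lemma finite_eigenvalues_adjacency_matrix: "finite {k. eigenvalue (adjacency_matrix n G) k}"
proof -
  have A: "adjacency_matrix n G \<in> carrier_mat n n" by (simp add: adjacency_matrix_def)
  then have "char_poly (adjacency_matrix n G) \<noteq> 0" using degree_monic_char_poly[OF A] by auto
  then show ?thesis by (simp add: eigenvalue_root_char_poly[OF A] poly_roots_finite)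
qed

lemma adj_commute: "adj G i j = adj G j i"
  by (simp add: insert_commute)

text \<open>The maximum of the Rayleigh quotient is an eigenvalue, hence at most the largest one;
  the all-ones vector is the test vector.\<close>

lemma graph_spectral_radius_ge:
  assumes "0 < n"
  shows "(\<Sum>i<n. \<Sum>j<n. adj G i j) \<le> real n * graph_spectral_radius n G"
proof (rule symmetric_form_max[of n "adj G", OF assms adj_commute])
  fix x M
  assume x: "\<exists>i<n. x i \<noteq> 0" "\<And>i. i < n \<Longrightarrow> (\<Sum>j<n. adj G i j * x j) = M * x i"
    and M: "\<And>y. (\<Sum>i<n. \<Sum>j<n. adj G i j * y i * y j) \<le> M * (\<Sum>i<n. (y i)\<^sup>2)"
  have "eigenvalue (adjacency_matrix n G) M"
    unfolding eigenvalue_adjacency_matrix_iff using x by blast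
  then have "M \<le> graph_spectral_radius n G"
    unfolding graph_spectral_radius_def using finite_eigenvalues_adjacency_matrix by (intro Max_ge) auto
  have "(\<Sum>i<n. \<Sum>j<n. adj G i j) \<le> M * real n"
    using M[of "\<lambda>_. 1"] by simp
  also have "\<dots> \<le> graph_spectral_radius n G * real n"
    using \<open>M \<le> _\<close> by (intro mult_right_mono) auto
  finally show ?thesis by (simp add: mult.commute)
qed

text \<open>Nonnegative test vectors suffice because the matrix entries are nonnegative: replacing
  an eigenvector by its absolute values keeps the norm and does not decrease the form.\<close>

lemma graph_spectral_radius_le:
  assumes "0 < n"
    and "\<And>y. (\<And>i. 0 \<le> y i) \<Longrightarrow> (\<Sum>i<n. \<Sum>j<n. adj G i j * y i * y j) \<le> M * (\<Sum>i<n. (y i)\<^sup>2)"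
  shows "graph_spectral_radius n G \<le> M"
proof -
  let ?S = "{k. eigenvalue (adjacency_matrix n G) k}"
  \<comment> \<open>Guarantees that the \<open>Max\<close> in the spectral radius is a genuine
    one.\<close>
  have "?S \<noteq> {}"
  proof (rule symmetric_form_max[of n "adj G", OF assms(1) adj_commute])
    fix x k
    assume "\<exists>i<n. x i \<noteq> 0" "\<And>i. i < n \<Longrightarrow> (\<Sum>j<n. adj G i j * x j) = k * x i"
    then have "k \<in> ?S" unfolding mem_Collect_eq eigenvalue_adjacency_matrix_iff by blast
    then show "?S \<noteq> {}" by blast
  qed
  moreover have "k \<le> M" if k: "k \<in> ?S" for k
  proof -
    obtain x where x: "\<exists>i<n. x i \<noteq> 0"
      and ev: "\<forall>i<n. (\<Sum>j<n. adj G i j * x j) = k * x i"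
      using k unfolding mem_Collect_eq eigenvalue_adjacency_matrix_iff by blast
    have "k * (\<Sum>i<n. (x i)\<^sup>2) = (\<Sum>i<n. x i * (k * x i))"
      by (simp add: sum_distrib_left power2_eq_square mult_ac)
    also have "\<dots> = (\<Sum>i<n. x i * (\<Sum>j<n. adj G i j * x j))"
      using ev by simp
    also have "\<dots> \<le> (\<Sum>i<n. \<Sum>j<n. adj G i j * \<bar>x i\<bar> * \<bar>x j\<bar>)"
      unfolding sum_distrib_left
      by (intro sum_mono) (auto simp flip: abs_mult)
    also have "\<dots> \<le> M * (\<Sum>i<n. (x i)\<^sup>2)"
      using assms(2)[of "\<lambda>i. \<bar>x i\<bar>"] by simp
    finally have "k * (\<Sum>i<n. (x i)\<^sup>2) \<le> M * (\<Sum>i<n. (x i)\<^sup>2)" .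
    moreover have "(\<Sum>i<n. (x i)\<^sup>2) > 0"
      using x by (auto intro!: sum_pos2)
    ultimately show ?thesis by simp
  qed
  ultimately show ?thesis
    unfolding graph_spectral_radius_def using finite_eigenvalues_adjacency_matrix by (intro Max.boundedI) auto
qed

section \<open>Quadratic forms on decreasing vectors\<close>

text \<open>With \<open>m = i + 1\<close>, the ratio \<open>i / m\<close> is at most 1, so
  \<open>(i / m) powr c \<ge> i / m\<close>; multiply by \<open>m powr c\<close>. This also covers
  \<open>i = 0\<close>.\<close>

lemma powr_Suc_diff_le:
  fixes c :: real
  assumes "0 < c" "c \<le> 1"
  shows "real (Suc i) powr c - real i powr c \<le> real (Suc i) powr (c - 1)"
proof -
  define m where "m = real (Suc i)"
  have m: "m > 0" by (simp add: m_def)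
  have "real i powr c \<ge> m powr c * (real i / m)"
  proof -
    have "(real i / m) powr 1 \<le> (real i / m) powr c"
      using assms by (intro powr_mono') (auto simp: m_def)
    then have "real i / m \<le> (real i / m) powr c" using m by simp
    then show ?thesis using m by (simp add: powr_divide field_simps)
  qed
  moreover have "m powr c * (real i / m) = m powr c - m powr (c - 1)"
    using m by (simp add: powr_diff m_def field_simps)
  ultimately show ?thesis by (simp add: m_def)
qed

lemma powr_Suc_diff_ge:
  fixes s :: real
  assumes "0 < s" "s \<le> 1"
  shows "s * real (Suc i) powr (s - 1) \<le> real (Suc i) powr s - real i powr s"
\<comment> \<open>The mean value theorem is applied on \<open>[i, i + 1]\<close>;
  \<open>i = 0\<close> is split off because the derivative of \<open>x powr s\<close> at 0 fails to
  exist for \<open>s < 1\<close>.\<close>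
proof (cases "i = 0")
  case False
  have "\<exists>z::real. real i < z \<and> z < real (Suc i) \<and>
    real (Suc i) powr s - real i powr s = (real (Suc i) - real i) * (s * z powr (s - 1))"
    using False by (intro MVT2) (auto intro!: derivative_eq_intros simp: powr_diff)
  then obtain z where z: "real i < z" "z < real (Suc i)"
    "real (Suc i) powr s - real i powr s = s * z powr (s - 1)" by auto
  have "real (Suc i) powr (s - 1) \<le> z powr (s - 1)"
    using z assms False by (intro powr_mono2') auto
  with z assms show ?thesis by simp
qed (use assms in auto)

lemma sum_powr_le:
  fixes s :: real
  assumes "0 < s" "s \<le> 1"
  shows "(\<Sum>i<n. real (Suc i) powr (s - 1)) \<le> real n powr s / s"
proof -
  have "s * (\<Sum>i<n. real (Suc i) powr (s - 1)) \<le> (\<Sum>i<n. real (Suc i) powr s - real i powr s)"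
    unfolding sum_distrib_left using powr_Suc_diff_ge[OF assms] by (intro sum_mono)
  also have "\<dots> = real n powr s" using assms sum_lessThan_telescope[of "\<lambda>i. real i powr s" n] by simp
  finally show ?thesis using assms by (simp add: field_simps del: of_nat_Suc)
qed

text \<open>Cauchy-Schwarz against the weights \<open>(i + 1) powr (c - 1)\<close>. Their squares
  have exponent \<open>2 * c - 2 > -1\<close>, so \<open>sum_powr_le\<close> applies with the
  positive exponent \<open>s = 2 * c - 1\<close>.\<close>

lemma sum_mult_powr_Suc_le:
  fixes c :: real and z :: "nat \<Rightarrow> real"
  assumes "1 / 2 < c" "c \<le> 1" "\<And>i. 0 \<le> z i"
  shows "(\<Sum>i<n. z i * (real (Suc i) powr c - real i powr c))
      \<le> sqrt (\<Sum>i<n. (z i)\<^sup>2) * sqrt (real n powr (2 * c - 1) / (2 * c - 1))"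
proof -
  have "(\<Sum>i<n. z i * (real (Suc i) powr c - real i powr c))
      \<le> (\<Sum>i<n. z i * real (Suc i) powr (c - 1))"
    using assms powr_Suc_diff_le[of c] by (intro sum_mono mult_left_mono) auto
  also have "\<dots> \<le> sqrt ((\<Sum>i<n. (z i)\<^sup>2) * (\<Sum>i<n. (real (Suc i) powr (c - 1))\<^sup>2))"
    by (intro real_le_rsqrt Cauchy_Schwarz_ineq_sum)
  also have "(\<Sum>i<n. (real (Suc i) powr (c - 1))\<^sup>2) = (\<Sum>i<n. real (Suc i) powr ((2 * c - 1) - 1))"
    by (simp add: power2_eq_square del: of_nat_Suc flip: powr_add)
  also have "sqrt ((\<Sum>i<n. (z i)\<^sup>2) * \<dots>)
      \<le> sqrt ((\<Sum>i<n. (z i)\<^sup>2) * (real n powr (2 * c - 1) / (2 * c - 1)))"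
    using assms sum_powr_le[of "2 * c - 1" n]
    by (intro real_sqrt_le_mono mult_left_mono) (auto intro: sum_nonneg)
  finally show ?thesis by (simp only: real_sqrt_mult)
qed

lemma sum_mult_le_sqrt:
  fixes z :: "nat \<Rightarrow> real"
  shows "(\<Sum>i<n. z i) \<le> sqrt (\<Sum>i<n. (z i)\<^sup>2) * sqrt n"
proof -
  have "(\<Sum>i<n. z i * 1)\<^sup>2 \<le> (\<Sum>i<n. (z i)\<^sup>2) * (\<Sum>i<n. 1\<^sup>2)" by (rule Cauchy_Schwarz_ineq_sum)
  from real_le_rsqrt[OF this] show ?thesis by (simp add: real_sqrt_mult)
qed

text \<open>The two sums differ by a telescoping sum of \<open>z k * g k\<close>, whose boundary
  terms vanish by the assumptions.\<close>

lemma summation_by_parts: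
  fixes z g :: "nat \<Rightarrow> real"
  assumes "g 0 = 0" "z n = 0"
  shows "(\<Sum>k<n. (z k - z (Suc k)) * g (Suc k)) = (\<Sum>i<n. z i * (g (Suc i) - g i))"
proof -
  have "(\<Sum>k<n. (z k - z (Suc k)) * g (Suc k)) - (\<Sum>i<n. z i * (g (Suc i) - g i))
    = - (\<Sum>k<n. z (Suc k) * g (Suc k) - z k * g k)"
    by (simp add: algebra_simps flip: sum_subtractf sum_negf)
  also have "\<dots> = 0" using assms sum_lessThan_telescope[of "\<lambda>k. z k * g k" n] by simp
  finally show ?thesis by simp
qed

text \<open>On \<open>{..<n}\<close>, \<open>z\<close> is the combination of the indicators of the
  segments \<open>{..k}\<close> with coefficients \<open>z k - z (Suc k)\<close>; expand the form
  bilinearly.\<close>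

lemma layer_cake_form:
  fixes b :: "nat \<Rightarrow> nat \<Rightarrow> real"
  assumes "z n = 0"
  shows "(\<Sum>i<n. \<Sum>j<n. b i j * z i * z j) =
    (\<Sum>k<n. \<Sum>l<n. (z k - z (Suc k)) * (z l - z (Suc l)) * (\<Sum>i\<le>k. \<Sum>j\<le>l. b i j))"
proof -
  define d where "d k = z k - z (Suc k)" for k
  have layers: "(\<Sum>i<n. z i * f i) = (\<Sum>k<n. d k * (\<Sum>i\<le>k. f i))" for f
    using summation_by_parts[of "\<lambda>k. \<Sum>i<k. f i" z n] assms
    by (simp add: d_def flip: lessThan_Suc_atMost)
  have "(\<Sum>i<n. \<Sum>j<n. b i j * z i * z j) = (\<Sum>i<n. z i * (\<Sum>j<n. z j * b i j))"
    by (simp add: sum_distrib_left mult_ac)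
  also have "\<dots> = (\<Sum>k<n. d k * (\<Sum>i\<le>k. \<Sum>l<n. d l * (\<Sum>j\<le>l. b i j)))"
    unfolding layers ..
  also have "\<dots> = (\<Sum>k<n. d k * (\<Sum>l<n. \<Sum>i\<le>k. d l * (\<Sum>j\<le>l. b i j)))"
    by (subst sum.swap) (rule refl)
  also have "\<dots> = (\<Sum>k<n. \<Sum>l<n. d k * d l * (\<Sum>i\<le>k. \<Sum>j\<le>l. b i j))"
    by (simp add: sum_distrib_left mult.assoc)
  finally show ?thesis by (simp add: d_def)
qed

text \<open>Monotonicity makes the layer coefficients nonnegative, so the segment bound can be
  inserted termwise. Each of its two summands is a function of \<open>k\<close> times a function of
  \<open>l\<close>, so the double sum factors.\<close>

lemma decreasing_form_le:
  fixes b :: "nat \<Rightarrow> nat \<Rightarrow> real" and c D :: real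
  assumes c: "1 / 2 < c" "c \<le> 1"
    and bound: "\<And>k l. k < n \<Longrightarrow> l < n \<Longrightarrow> (\<Sum>i\<le>k. \<Sum>j\<le>l. b i j)
        \<le> D * (real (Suc k) powr c * real (Suc l) + real (Suc k) * real (Suc l) powr c)"
    and D: "0 \<le> D" and z: "antimono z" "\<And>i. 0 \<le> z i" "z n = 0"
  shows "(\<Sum>i<n. \<Sum>j<n. b i j * z i * z j)
      \<le> 2 * D / sqrt (2 * c - 1) * real n powr c * (\<Sum>i<n. (z i)\<^sup>2)"
proof (cases "n = 0")
  case False
  define d where "d k = z k - z (Suc k)" for k
  have d: "0 \<le> d k" for k using antimonoD[OF z(1), of k "Suc k"] by (simp add: d_def)
  define P where "P = (\<Sum>k<n. d k * real (Suc k) powr c)"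
  define Q where "Q = (\<Sum>k<n. d k * real (Suc k))"
  \<comment> \<open>Undoing the layers turns \<open>P\<close> into a sum weighted by increments of
    \<open>i powr c\<close>, and \<open>Q\<close> into the plain sum of \<open>z\<close>; each is
    then handled by Cauchy-Schwarz.\<close>
  have P: "P = (\<Sum>i<n. z i * (real (Suc i) powr c - real i powr c))"
    unfolding P_def d_def using c z by (subst summation_by_parts) auto
  have Q: "Q = (\<Sum>i<n. z i)"
    unfolding Q_def d_def using z by (subst summation_by_parts) auto
  have "(\<Sum>i<n. \<Sum>j<n. b i j * z i * z j) = (\<Sum>k<n. \<Sum>l<n. d k * d l * (\<Sum>i\<le>k. \<Sum>j\<le>l. b i j))"
    unfolding d_def by (rule layer_cake_form) fact
  also have "\<dots> \<le> (\<Sum>k<n. \<Sum>l<n. d k * d l *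
      (D * (real (Suc k) powr c * real (Suc l) + real (Suc k) * real (Suc l) powr c)))"
    using d by (intro sum_mono mult_left_mono bound) auto
  also have "\<dots> = D * (P * Q + Q * P)"
    unfolding P_def Q_def sum_product sum_distrib_left
    by (simp add: algebra_simps sum.distrib sum_distrib_left del: of_nat_Suc)
  also have "\<dots> = 2 * D * (P * Q)" by simp
  also have "\<dots> \<le> 2 * D * (real n powr c / sqrt (2 * c - 1) * (\<Sum>i<n. (z i)\<^sup>2))"
  proof (rule mult_left_mono)
    have "P * Q \<le> (sqrt (\<Sum>i<n. (z i)\<^sup>2) * sqrt (real n powr (2 * c - 1) / (2 * c - 1)))
        * (sqrt (\<Sum>i<n. (z i)\<^sup>2) * sqrt n)"
      unfolding P Q using c z(2)
      by (intro mult_mono sum_mult_powr_Suc_le sum_mult_le_sqrt)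
        (auto intro!: sum_nonneg mult_nonneg_nonneg)
    also have "\<dots> = (sqrt (\<Sum>i<n. (z i)\<^sup>2) * sqrt (\<Sum>i<n. (z i)\<^sup>2))
        * (sqrt (real n powr (2 * c - 1) * real n) / sqrt (2 * c - 1))"
      by (simp only: real_sqrt_mult real_sqrt_divide times_divide_eq_left times_divide_eq_right mult_ac)
    also have "real n powr (2 * c - 1) * real n = (real n powr c)\<^sup>2"
      using False by (simp add: powr_diff power2_eq_square flip: powr_add)
    also have "sqrt (\<Sum>i<n. (z i)\<^sup>2) * sqrt (\<Sum>i<n. (z i)\<^sup>2) = (\<Sum>i<n. (z i)\<^sup>2)"
      by (simp add: sum_nonneg)
    finally show "P * Q \<le> real n powr c / sqrt (2 * c - 1) * (\<Sum>i<n. (z i)\<^sup>2)"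
      by (simp add: mult_ac)
  qed (use D in simp)
  finally show ?thesis by (simp add: mult_ac)
qed simp

section \<open>Locally sparse graphs\<close>

text \<open>Double counting: every edge inside \<open>S\<close> has exactly two orderings, and the
  diagonal contributes nothing since edges have two elements.\<close>

lemma sum_adj_eq_card:
  assumes G: "simple_graph G" and S: "finite S"
  shows "(\<Sum>i\<in>S. \<Sum>j\<in>S. adj G i j) = 2 * real (card {e \<in> edges G. e \<subseteq> S})"
proof -
  define P where "P = {p \<in> S \<times> S. {fst p, snd p} \<in> edges G}"
  let ?E = "{e \<in> edges G. e \<subseteq> S}"
  have fin: "finite P" "finite ?E" using S by (auto simp: P_def intro: finite_subset[of _ "Pow S"])
  have fibre: "card {p \<in> P. {fst p, snd p} = e} = 2" if e: "e \<in> ?E" for e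
  proof -
    obtain u v where uv: "e = {u, v}" "u \<noteq> v"
      using e G by (auto simp: simple_graph_def card_2_iff)
    have "{p \<in> P. {fst p, snd p} = e} = {(u, v), (v, u)}"
      using uv e by (auto simp: P_def doubleton_eq_iff insert_commute)
    then show ?thesis using uv(2) by simp
  qed
  have "(\<Sum>i\<in>S. \<Sum>j\<in>S. adj G i j) = (\<Sum>p\<in>S \<times> S. of_bool ({fst p, snd p} \<in> edges G))"
    by (simp add: sum.cartesian_product case_prod_unfold del: sum_of_bool_eq)
  also have "\<dots> = real (card P)"
    using S by (simp add: P_def Int_def)
  also have "card P = (\<Sum>e\<in>?E. card {p \<in> P. {fst p, snd p} = e})"
    unfolding card_eq_sum by (intro sum.group[symmetric] fin) (auto simp: P_def)
  also have "\<dots> = 2 * card ?E" using fibre by simp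
  finally show ?thesis by simp
qed

section \<open>Free graphs and their induced subgraphs\<close>

lemma finite_free_graphs: "finite (free_graphs n \<H>)"
proof (rule finite_subset)
  show "free_graphs n \<H> \<subseteq> Graph {..<n} ` Pow (Pow {..<n})"
  proof
    fix G assume "G \<in> free_graphs n \<H>"
    then have "G = Graph {..<n} (edges G)" "edges G \<subseteq> Pow {..<n}"
      by (auto simp: free_graphs_def simple_graph_def graph.expand)
    then show "G \<in> Graph {..<n} ` Pow (Pow {..<n})" by blast
  qed
qed simp

lemma card_edges_le_turan_number:
  assumes "G \<in> free_graphs n \<H>"
  shows "card (edges G) \<le> turan_number n \<H>"
proof -
  have "card (edges G) \<le> Max ((\<lambda>G. card (edges G)) ` free_graphs n \<H>)"
    using assms by (intro Max_ge finite_imageI finite_free_graphs) blast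
  moreover have "free_graphs n \<H> \<noteq> {}" using assms by blast
  ultimately show ?thesis by (simp add: turan_number_def)
qed

text \<open>Relabel the subgraph induced on \<open>S\<close> by \<open>{..<card S}\<close>. A
  forbidden copy in the relabelled graph pulls back to one in \<open>G\<close>, so the relabelled
  graph is again free.\<close>

lemma card_induced_edges_le_turan_number:
  assumes G: "G \<in> free_graphs n \<H>" and S: "S \<subseteq> {..<n}"
  shows "card {e \<in> edges G. e \<subseteq> S} \<le> turan_number (card S) \<H>"
proof -
  have finS: "finite S" using S finite_subset by blast
  obtain f where f: "bij_betw f S {..<card S}"
    using ex_bij_betw_finite_nat[OF finS] by (auto simp: lessThan_atLeast0)
  then have inj: "inj_on f S" and fS: "f ` S = {..<card S}" by (auto simp: bij_betw_def)
  let ?E = "{e \<in> edges G. e \<subseteq> S}"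
  define G' where "G' = Graph {..<card S} ((`) f ` ?E)"
  have simple: "\<And>e. e \<in> edges G \<Longrightarrow> card e = 2"
    using G by (auto simp: free_graphs_def simple_graph_def)
  have "simple_graph G'"
    unfolding simple_graph_def
  proof (intro conjI ballI)
    fix e assume "e \<in> edges G'"
    then obtain e' where e': "e = f ` e'" "e' \<in> edges G" "e' \<subseteq> S" by (auto simp: G'_def)
    show "e \<subseteq> verts G'" using e' fS by (auto simp: G'_def)
    show "card e = 2" using e' simple inj by (simp add: card_image inj_on_subset)
  qed (simp add: G'_def)
  moreover have "free_of \<H> G'"
    unfolding free_of_def
  proof (intro notI, elim bexE exE conjE)
    fix H T assume H: "H \<in> \<H>" and T: "subgraph T G'" and iso: "isomorphic T H"
    obtain h where h: "bij_betw h (verts T) (verts H)"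
      "\<And>u v. u \<in> verts T \<Longrightarrow> v \<in> verts T \<Longrightarrow> {u, v} \<in> edges T \<longleftrightarrow> {h u, h v} \<in> edges H"
      using iso by (auto simp: isomorphic_def)
    \<comment> \<open>\<open>T'\<close> is the pullback of the copy \<open>T\<close> along
      \<open>f\<close>; composing with \<open>h\<close> will identify it with
      \<open>H\<close>.\<close>
    define W where "W = {v \<in> S. f v \<in> verts T}"
    define T' where "T' = Graph W {e \<in> ?E. f ` e \<in> edges T}"
    have T_sub: "\<And>e. e \<in> edges T \<Longrightarrow> e \<subseteq> verts T" "verts T \<subseteq> {..<card S}"
      "edges T \<subseteq> (`) f ` ?E"
      using T by (auto simp: subgraph_def simple_graph_def G'_def)
    have "f ` W = f ` S \<inter> verts T" by (auto simp: W_def)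
    then have "f ` W = verts T" using T_sub(2) unfolding fS by (simp add: Int_absorb1)
    then have fW: "bij_betw f W (verts T)"
      using inj by (auto simp: bij_betw_def W_def intro: inj_on_subset)
    have "simple_graph T'"
      unfolding simple_graph_def T'_def W_def using finS simple T_sub(1) by auto
    moreover have "verts T' \<subseteq> verts G"
      using S G by (auto simp: T'_def W_def free_graphs_def)
    moreover have "edges T' \<subseteq> edges G" by (auto simp: T'_def)
    ultimately have "subgraph T' G" by (simp add: subgraph_def)
    moreover have "isomorphic T' H"
      unfolding isomorphic_def
    proof (intro exI conjI ballI)
      show "bij_betw (h \<circ> f) (verts T') (verts H)"
        using bij_betw_trans[OF fW h(1)] by (simp add: T'_def)
      fix u v assume "u \<in> verts T'" "v \<in> verts T'"
      then have uv: "u \<in> S" "v \<in> S" "f u \<in> verts T" "f v \<in> verts T"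
        by (auto simp: T'_def W_def)
      have "{u, v} \<in> edges T' \<longleftrightarrow> {f u, f v} \<in> edges T"
      proof
        assume e: "{f u, f v} \<in> edges T"
        \<comment> \<open>Edges of \<open>T\<close> are images of edges inside \<open>S\<close>;
          injectivity of \<open>f\<close> on \<open>S\<close> shows that the original edge is
          \<open>{u, v}\<close> itself.\<close>
        then obtain e' where e': "f ` {u, v} = f ` e'" "e' \<in> ?E" using T_sub(3) by auto
        then have "{u, v} = e'" using inj uv by (subst (asm) inj_on_image_eq_iff) auto
        with e e' show "{u, v} \<in> edges T'" by (auto simp: T'_def)
      qed (auto simp: T'_def)
      also have "\<dots> \<longleftrightarrow> {h (f u), h (f v)} \<in> edges H" using h(2) uv by blast
      finally show "{u, v} \<in> edges T' \<longleftrightarrow> {(h \<circ> f) u, (h \<circ> f) v} \<in> edges H" by simp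
    qed
    ultimately show False using G H by (auto simp: free_graphs_def free_of_def)
  qed
  ultimately have "G' \<in> free_graphs (card S) \<H>" by (simp add: free_graphs_def G'_def)
  then have "card (edges G') \<le> turan_number (card S) \<H>" by (rule card_edges_le_turan_number)
  moreover have "inj_on ((`) f) ?E"
    using inj by (auto intro!: inj_onI simp: inj_on_image_eq_iff)
  then have "card (edges G') = card ?E" by (simp add: G'_def card_image)
  ultimately show ?thesis by simp
qed

section \<open>Cuts and the quadratic form of a locally sparse graph\<close>

locale locally_sparse_graph =
  fixes G :: "nat graph" and n :: nat and C c :: real
  assumes simple: "simple_graph G" and C: "0 \<le> C" and c: "0 < c" "c \<le> 1"
    and sparse: "\<And>S. S \<subseteq> {..<n} \<Longrightarrow> S \<noteq> {} \<Longrightarrow>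
      real (card {e \<in> edges G. e \<subseteq> S}) \<le> C * real (card S) powr (1 + c)"
begin

text \<open>Induction removing blocks of size \<open>card A\<close> from \<open>B\<close>. A block
  and \<open>A\<close> together have at most \<open>2 * card A\<close> vertices, so sparsity bounds
  the pairs between them; the summand 1 accounts for the last, possibly incomplete block.
  \<open>A\<close> and \<open>B\<close> may overlap.\<close>

lemma cut_le_blocks:
  assumes "A \<subseteq> {..<n}" "A \<noteq> {}" "B \<subseteq> {..<n}"
  shows "(\<Sum>i\<in>A. \<Sum>j\<in>B. adj G i j)
    \<le> (real (card B) / real (card A) + 1) * (2 * C * (2 * real (card A)) powr (1 + c))"
  using assms(3)
proof (induction "card B" arbitrary: B rule: less_induct)
  case less
  have fin: "finite A" "finite B" using assms(1) less.prems finite_subset by blast+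
  have A0: "card A > 0" using fin(1) assms(2) by (simp add: card_gt_0_iff)
  define D where "D = 2 * C * (2 * real (card A)) powr (1 + c)"
  have D: "D \<ge> 0" using C by (simp add: D_def)
  have small: "(\<Sum>i\<in>A. \<Sum>j\<in>B'. adj G i j) \<le> D" if B': "B' \<subseteq> {..<n}" "card B' \<le> card A" for B'
  proof -
    have fin': "finite B'" using B'(1) finite_subset by blast
    have card: "card (A \<union> B') \<le> 2 * card A" using card_Un_le[of A B'] B'(2) by simp
    \<comment> \<open>Enlarge the rectangle to the square on the union, where pairs count edges
      twice.\<close>
    have "(\<Sum>i\<in>A. \<Sum>j\<in>B'. adj G i j) \<le> (\<Sum>i\<in>A \<union> B'. \<Sum>j\<in>A \<union> B'. adj G i j)"
      using fin(1) fin' by (intro order_trans[OF sum_mono sum_mono2] sum_mono2 sum_nonneg) auto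
    also have "\<dots> = 2 * real (card {e \<in> edges G. e \<subseteq> A \<union> B'})"
      using simple fin(1) fin' by (intro sum_adj_eq_card) auto
    also have "\<dots> \<le> 2 * (C * real (card (A \<union> B')) powr (1 + c))"
      using assms B' by (intro mult_left_mono sparse) auto
    also have "\<dots> \<le> 2 * (C * (2 * real (card A)) powr (1 + c))"
      using C c card by (intro mult_left_mono powr_mono2) auto
    finally show ?thesis by (simp add: D_def)
  qed
  show ?case unfolding D_def[symmetric]
  proof (cases "card B \<le> card A")
    case True
    have "(\<Sum>i\<in>A. \<Sum>j\<in>B. adj G i j) \<le> 1 * D" using small[OF less.prems True] by simp
    also have "\<dots> \<le> (real (card B) / real (card A) + 1) * D"
      using D by (intro mult_right_mono) auto
    finally show "(\<Sum>i\<in>A. \<Sum>j\<in>B. adj G i j) \<le> (real (card B) / real (card A) + 1) * D" .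
  next
    case False
    then obtain B' where B': "B' \<subseteq> B" "card B' = card A"
      using obtain_subset_with_card_n[of "card A" B] by (metis nat_le_linear)
    have cB: "card (B - B') = card B - card A"
      using B' fin(2) by (simp add: card_Diff_subset finite_subset)
    have "(\<Sum>i\<in>A. \<Sum>j\<in>B. adj G i j)
        = (\<Sum>i\<in>A. (\<Sum>j\<in>B - B'. adj G i j) + (\<Sum>j\<in>B'. adj G i j))"
      by (intro sum.cong refl sum.subset_diff B'(1) fin(2))
    also have "\<dots> = (\<Sum>i\<in>A. \<Sum>j\<in>B - B'. adj G i j) + (\<Sum>i\<in>A. \<Sum>j\<in>B'. adj G i j)"
      by (rule sum.distrib)
    also have "\<dots> \<le> (real (card (B - B')) / real (card A) + 1) * D + D"
    proof (rule add_mono)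
      show "(\<Sum>i\<in>A. \<Sum>j\<in>B - B'. adj G i j) \<le> (real (card (B - B')) / real (card A) + 1) * D"
        unfolding D_def using A0 False less.prems cB by (intro less.hyps) auto
      show "(\<Sum>i\<in>A. \<Sum>j\<in>B'. adj G i j) \<le> D"
        using B' less.prems by (intro small) auto
    qed
    \<comment> \<open>Removing one block lowers the quotient by exactly 1, which pays for that
      block's \<open>D\<close>.\<close>
    also have "real (card (B - B')) / real (card A) + 1 = real (card B) / real (card A)"
      using cB False A0 by (simp add: of_nat_diff field_simps)
    finally show "(\<Sum>i\<in>A. \<Sum>j\<in>B. adj G i j) \<le> (real (card B) / real (card A) + 1) * D"
      by (simp add: distrib_right)
  qed
qed

lemma cut_le_ordered:
  assumes "A \<subseteq> {..<n}" "A \<noteq> {}" "B \<subseteq> {..<n}" "card A \<le> card B"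
  shows "(\<Sum>i\<in>A. \<Sum>j\<in>B. adj G i j) \<le> 16 * C * (real (card A) powr c * real (card B))"
proof -
  define a b where "a = real (card A)" and "b = real (card B)"
  have "finite A" using assms(1) finite_subset by blast
  then have ab: "0 < a" "a \<le> b" using assms by (auto simp: a_def b_def card_gt_0_iff)
  \<comment> \<open>Source of the 16: \<open>2 powr (1 + c) \<le> 4\<close> gives a factor 8, and
    \<open>b / a + 1 \<le> 2 * (b / a)\<close> doubles it.\<close>
  have "(2::real) powr (1 + c) \<le> 2 powr 2" using c by (intro powr_mono) auto
  then have "2 * C * (2 powr (1 + c) * (a * a powr c)) \<le> 2 * C * (4 * (a * a powr c))"
    using C ab by (intro mult_left_mono mult_right_mono) auto
  moreover have "(2 * a) powr (1 + c) = 2 powr (1 + c) * (a * a powr c)"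
    using ab by (simp add: powr_mult powr_add)
  ultimately have D: "2 * C * (2 * a) powr (1 + c) \<le> 8 * C * (a * a powr c)" by simp
  have "(\<Sum>i\<in>A. \<Sum>j\<in>B. adj G i j) \<le> (b / a + 1) * (2 * C * (2 * a) powr (1 + c))"
    unfolding a_def b_def using assms by (intro cut_le_blocks)
  also have "\<dots> \<le> (2 * (b / a)) * (8 * C * (a * a powr c))"
  proof (rule mult_mono)
    show "b / a + 1 \<le> 2 * (b / a)" using ab by (simp add: field_simps)
  qed (use D ab C in auto)
  also have "\<dots> = 16 * C * (a powr c * b)" using ab by simp
  finally show ?thesis by (simp add: a_def b_def)
qed

text \<open>Adding the bounds for both size orders avoids a case split and yields the shape required
  by \<open>decreasing_form_le\<close>.\<close>

lemma cut_le:
  assumes "A \<subseteq> {..<n}" "A \<noteq> {}" "B \<subseteq> {..<n}" "B \<noteq> {}"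
  shows "(\<Sum>i\<in>A. \<Sum>j\<in>B. adj G i j)
    \<le> 16 * C * (real (card A) powr c * real (card B) + real (card A) * real (card B) powr c)"
proof (cases "card A \<le> card B")
  case True
  have "(\<Sum>i\<in>A. \<Sum>j\<in>B. adj G i j) \<le> 16 * C * (real (card A) powr c * real (card B))"
    using assms True by (intro cut_le_ordered)
  also have "\<dots> \<le> 16 * C * (real (card A) powr c * real (card B) + real (card A) * real (card B) powr c)"
    using C by (intro mult_left_mono) auto
  finally show ?thesis .
next
  case False
  have "(\<Sum>i\<in>A. \<Sum>j\<in>B. adj G i j) = (\<Sum>j\<in>B. \<Sum>i\<in>A. adj G j i)"
    by (subst sum.swap) (simp only: adj_commute)
  also have "\<dots> \<le> 16 * C * (real (card B) powr c * real (card A))"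
    using assms False by (intro cut_le_ordered) auto
  also have "\<dots> \<le> 16 * C * (real (card A) powr c * real (card B) + real (card A) * real (card B) powr c)"
    using C by (intro mult_left_mono) auto
  finally show ?thesis .
qed

lemma adjacency_form_le:
  assumes "1 / 2 < c" and y: "\<And>i. 0 \<le> y i"
  shows "(\<Sum>i<n. \<Sum>j<n. adj G i j * y i * y j)
    \<le> 32 * C / sqrt (2 * c - 1) * real n powr c * (\<Sum>i<n. (y i)\<^sup>2)"
proof -
  define vs where "vs = sort_key (\<lambda>i. - y i) [0..<n]"
  define \<pi> where "\<pi> i = vs ! i" for i
  have len: "length vs = n" and "distinct vs" "set vs = {..<n}"
    by (auto simp: vs_def)
  then have bij: "bij_betw \<pi> {..<n} {..<n}"
    unfolding \<pi>_def by (intro bij_betw_nth) auto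
  \<comment> \<open>\<open>\<pi>\<close> lists the vertices by decreasing \<open>y\<close>.
    Extending by 0 keeps \<open>z\<close> decreasing, as \<open>y\<close> is nonnegative, and
    supplies the boundary value \<open>z n = 0\<close>.\<close>
  define z where "z i = (if i < n then y (\<pi> i) else 0)" for i
  have "sorted (map (\<lambda>i. - y i) vs)" unfolding vs_def by simp
  then have "y (\<pi> j) \<le> y (\<pi> i)" if "i \<le> j" "j < n" for i j
    using that len sorted_nth_mono[of "map (\<lambda>i. - y i) vs" i j] by (simp add: \<pi>_def)
  then have z: "antimono z" "\<And>i. 0 \<le> z i" "z n = 0"
    using y by (auto simp: z_def intro!: antimonoI)
  have inj: "inj_on \<pi> {..k}" if "k < n" for k
    using bij that by (auto simp: bij_betw_def intro: inj_on_subset)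
  have sub: "\<pi> ` {..k} \<subseteq> {..<n}" if "k < n" for k
    using bij that by (auto simp: bij_betw_def)
  have "(\<Sum>i<n. \<Sum>j<n. adj G (\<pi> i) (\<pi> j) * z i * z j)
      \<le> 2 * (16 * C) / sqrt (2 * c - 1) * real n powr c * (\<Sum>i<n. (z i)\<^sup>2)"
  proof (rule decreasing_form_le)
    fix k l assume kl: "k < n" "l < n"
    \<comment> \<open>Initial segments of the sorted order are vertex sets of sizes
      \<open>Suc k\<close> and \<open>Suc l\<close>, so their block sum is a cut.\<close>
    have "(\<Sum>i\<le>k. \<Sum>j\<le>l. adj G (\<pi> i) (\<pi> j)) = (\<Sum>i\<in>\<pi> ` {..k}. \<Sum>j\<in>\<pi> ` {..l}. adj G i j)"
      using inj kl by (simp add: sum.reindex del: sum_of_bool_eq)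
    also have "\<dots> \<le> 16 * C * (real (card (\<pi> ` {..k})) powr c * real (card (\<pi> ` {..l}))
        + real (card (\<pi> ` {..k})) * real (card (\<pi> ` {..l})) powr c)"
      using sub kl by (intro cut_le) auto
    finally show "(\<Sum>i\<le>k. \<Sum>j\<le>l. adj G (\<pi> i) (\<pi> j)) \<le> 16 * C *
        (real (Suc k) powr c * real (Suc l) + real (Suc k) * real (Suc l) powr c)"
      using inj kl by (simp add: card_image del: sum_of_bool_eq)
  qed (use assms c C z in auto)
  also have "(\<Sum>i<n. \<Sum>j<n. adj G (\<pi> i) (\<pi> j) * z i * z j)
      = (\<Sum>i<n. \<Sum>j<n. adj G (\<pi> i) (\<pi> j) * y (\<pi> i) * y (\<pi> j))"
    by (intro sum.cong refl) (simp add: z_def)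
  also have "\<dots> = (\<Sum>i<n. \<Sum>j<n. adj G (\<pi> i) j * y (\<pi> i) * y j)"
    by (intro sum.cong refl sum.reindex_bij_betw[OF bij])
  also have "\<dots> = (\<Sum>i<n. \<Sum>j<n. adj G i j * y i * y j)"
    by (rule sum.reindex_bij_betw[OF bij])
  also have "(\<Sum>i<n. (z i)\<^sup>2) = (\<Sum>i<n. (y (\<pi> i))\<^sup>2)"
    by (intro sum.cong refl) (simp add: z_def)
  also have "\<dots> = (\<Sum>i<n. (y i)\<^sup>2)"
    by (rule sum.reindex_bij_betw[OF bij])
  finally show ?thesis by simp
qed

end

section \<open>Comparison of the two extremal numbers\<close>

lemma spectral_turan_number_le:
  fixes c C :: real
  assumes c: "1 / 2 < c" "c \<le> 1" and C: "0 \<le> C" and n: "0 < n"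
    and ex: "\<And>m. 0 < m \<Longrightarrow> real (turan_number m \<H>) \<le> C * real m powr (1 + c)"
  shows "spectral_turan_number n \<H> \<le> 32 * C / sqrt (2 * c - 1) * real n powr c"
proof (cases "free_graphs n \<H> = {}")
  case True
  then show ?thesis using c C by (simp add: spectral_turan_number_def)
next
  case False
  have "graph_spectral_radius n G \<le> 32 * C / sqrt (2 * c - 1) * real n powr c"
    if G: "G \<in> free_graphs n \<H>" for G
  proof -
    interpret locally_sparse_graph G n C c
    proof
      fix S assume S: "S \<subseteq> {..<n}" "S \<noteq> {}"
      then have "0 < card S" by (simp add: card_gt_0_iff finite_subset[OF S(1)])
      \<comment> \<open>\<open>S\<close> can have any positive size, which is why \<open>ex\<close>
        is demanded for all \<open>m > 0\<close> and not just for large \<open>m\<close>.\<close>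
      then have "real (turan_number (card S) \<H>) \<le> C * real (card S) powr (1 + c)" by (rule ex)
      moreover have "card {e \<in> edges G. e \<subseteq> S} \<le> turan_number (card S) \<H>"
        using G S(1) by (rule card_induced_edges_le_turan_number)
      ultimately show "real (card {e \<in> edges G. e \<subseteq> S}) \<le> C * real (card S) powr (1 + c)"
        by linarith
    qed (use c C G in \<open>auto simp: free_graphs_def\<close>)
    show ?thesis by (rule graph_spectral_radius_le[OF n]) (rule adjacency_form_le[OF assms(1)])
  qed
  then show ?thesis
    unfolding spectral_turan_number_def if_not_P[OF False]
    by (intro Max.boundedI) (use False finite_free_graphs in auto)
qed

text \<open>Take an edge-extremal graph: its adjacency entries sum to twice its number of edges, and
  its spectral radius is at most the spectral extremal number.\<close>

lemma turan_number_le_spectral: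
  assumes n: "0 < n"
  shows "2 * real (turan_number n \<H>) \<le> real n * spectral_turan_number n \<H>"
proof (cases "free_graphs n \<H> = {}")
  case True
  then show ?thesis by (simp add: spectral_turan_number_def turan_number_def)
next
  case False
  have "turan_number n \<H> \<in> (\<lambda>G. card (edges G)) ` free_graphs n \<H>"
    unfolding turan_number_def if_not_P[OF False]
    by (intro Max_in) (use False finite_free_graphs in auto)
  then obtain G where G: "G \<in> free_graphs n \<H>" "turan_number n \<H> = card (edges G)" by auto
  then have simple: "simple_graph G" and "{e \<in> edges G. e \<subseteq> {..<n}} = edges G"
    by (auto simp: free_graphs_def simple_graph_def)
  then have "2 * real (turan_number n \<H>) = (\<Sum>i<n. \<Sum>j<n. adj G i j)"
    using sum_adj_eq_card[OF simple, of "{..<n}"] G(2) by simp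
  also have "\<dots> \<le> real n * graph_spectral_radius n G" using n by (rule graph_spectral_radius_ge)
  also have "graph_spectral_radius n G \<le> spectral_turan_number n \<H>"
    unfolding spectral_turan_number_def if_not_P[OF False] using G(1)
    by (intro Max_ge finite_imageI finite_free_graphs) blast
  finally show ?thesis by (simp add: mult_left_mono)
qed

text \<open>Turns an asymptotic bound into one valid at every positive \<open>n\<close>, as needed
  for small vertex sets. The finitely many exceptional values are absorbed into the constant because
  \<open>n powr a \<ge> 1\<close>.\<close>

lemma bigo_powr_global_bound:
  fixes f :: "nat \<Rightarrow> real"
  assumes "f \<in> O(\<lambda>n. real n powr a)" "0 \<le> a"
  obtains C where "0 \<le> C" "\<And>n. 0 < n \<Longrightarrow> f n \<le> C * real n powr a"
proof -
  obtain C0 where C0: "C0 > 0" "eventually (\<lambda>n. norm (f n) \<le> C0 * norm (real n powr a)) at_top"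
    using assms(1) by (auto elim!: landau_o.bigE)
  then obtain N where N: "\<And>n. n \<ge> N \<Longrightarrow> \<bar>f n\<bar> \<le> C0 * real n powr a"
    by (auto simp: eventually_at_top_linorder)
  define C where "C = C0 + (\<Sum>k<N. \<bar>f k\<bar>)"
  have sum0: "0 \<le> (\<Sum>k<N. \<bar>f k\<bar>)" by (intro sum_nonneg) auto
  show thesis
  proof (rule that)
    show "0 \<le> C" using C0 sum0 by (simp add: C_def)
    fix n :: nat assume n: "0 < n"
    have ge1: "1 \<le> real n powr a" using n assms(2) by (intro ge_one_powr_ge_zero) auto
    have "f n \<le> C0 * real n powr a + (\<Sum>k<N. \<bar>f k\<bar>) * real n powr a"
    proof (cases "n < N")
      case True
      then have "\<bar>f n\<bar> \<le> (\<Sum>k<N. \<bar>f k\<bar>)" by (intro member_le_sum) auto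
      also have "\<dots> \<le> (\<Sum>k<N. \<bar>f k\<bar>) * real n powr a"
        using mult_left_mono[OF ge1 sum0] by simp
      finally show ?thesis using C0(1) by (smt (verit) mult_nonneg_nonneg powr_ge_zero)
    next
      case False
      then show ?thesis using N[of n] sum0
        by (smt (verit) mult_nonneg_nonneg powr_ge_zero not_less)
    qed
    then show "f n \<le> C * real n powr a" by (simp add: C_def distrib_right)
  qed
qed

theorem theorem1p5:
  fixes c :: real and \<H> :: "'b graph set"
  assumes "1 / 2 < c" and "c \<le> 1"
    and "\<forall>H\<in>\<H>. simple_graph H"
  shows "((\<lambda>n. real (turan_number n \<H>)) \<in> O(\<lambda>n. real n powr (1 + c)) \<longleftrightarrow>
          (\<lambda>n. spectral_turan_number n \<H>) \<in> O(\<lambda>n. real n powr c)) \<and>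
         ((\<lambda>n. real (turan_number n \<H>)) \<in> \<Theta>(\<lambda>n. real n powr (1 + c)) \<longrightarrow>
          (\<lambda>n. spectral_turan_number n \<H>) \<in> \<Theta>(\<lambda>n. real n powr c))"
proof -
  let ?ex = "\<lambda>n. real (turan_number n \<H>)" and ?spex = "\<lambda>n. spectral_turan_number n \<H>"
  have powr: "real n powr (1 + c) = real n * real n powr c" if "0 < n" for n
    using that by (simp add: powr_add)
  \<comment> \<open>Allows the norms in the Landau bounds to be dropped; \<open>n = 0\<close> is
    excluded since the spectral radius is unspecified there.\<close>
  have nonneg: "0 \<le> ?spex n" if n: "0 < n" for n
  proof -
    have "0 \<le> real n * ?spex n" using turan_number_le_spectral[OF n, of \<H>] by linarith
    then show ?thesis using n by (simp add: zero_le_mult_iff)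
  qed
  have upper: "?spex \<in> O(\<lambda>n. real n powr c)" if ex: "?ex \<in> O(\<lambda>n. real n powr (1 + c))"
  proof -
    obtain C where C: "0 \<le> C" "\<And>n. 0 < n \<Longrightarrow> ?ex n \<le> C * real n powr (1 + c)"
      using bigo_powr_global_bound[OF ex] assms by auto
    show ?thesis
    proof (intro bigoI eventually_mono[OF eventually_gt_at_top[of 0]])
      fix n :: nat assume n: "0 < n"
      show "norm (?spex n) \<le> 32 * C / sqrt (2 * c - 1) * norm (real n powr c)"
        using spectral_turan_number_le[OF assms(1,2) C(1) n C(2)] nonneg[OF n] by simp
    qed
  qed
  have lower: "?ex \<in> O(\<lambda>n. real n powr (1 + c))" if spex: "?spex \<in> O(\<lambda>n. real n powr c)"
  proof -
    obtain C where C: "eventually (\<lambda>n. norm (?spex n) \<le> C * norm (real n powr c)) at_top"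
      using spex by (auto elim!: landau_o.bigE)
    show ?thesis
    proof (intro bigoI eventually_mono[OF eventually_conj[OF C eventually_gt_at_top[of 0]]])
      fix n :: nat assume n: "norm (?spex n) \<le> C * norm (real n powr c) \<and> 0 < n"
      then have "?ex n \<le> real n * ?spex n" using turan_number_le_spectral[of n \<H>] by linarith
      also have "\<dots> \<le> real n * (C * real n powr c)" using n by (intro mult_left_mono) auto
      finally show "norm (?ex n) \<le> C * norm (real n powr (1 + c))" using n by (simp add: powr mult_ac)
    qed
  qed
  \<comment> \<open>The lower half of the \<Theta> claim again comes from
    \<open>turan_number_le_spectral\<close>, after dividing by \<open>n\<close>; the upper half is
    \<open>upper\<close>.\<close>
  have omega: "?spex \<in> \<Omega>(\<lambda>n. real n powr c)" if "?ex \<in> \<Omega>(\<lambda>n. real n powr (1 + c))"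
  proof -
    have "(\<lambda>n. real n powr (1 + c)) \<in> O(?ex)" using that by (simp add: bigomega_iff_bigo)
    then obtain C where C: "0 < C"
      "eventually (\<lambda>n. norm (real n powr (1 + c)) \<le> C * norm (?ex n)) at_top"
      by (auto elim!: landau_o.bigE)
    have "(\<lambda>n. real n powr c) \<in> O(?spex)"
    proof (intro bigoI eventually_mono[OF eventually_conj[OF C(2) eventually_gt_at_top[of 0]]])
      fix n :: nat assume n: "norm (real n powr (1 + c)) \<le> C * norm (?ex n) \<and> 0 < n"
      have "real n * real n powr c \<le> C * ?ex n" using n powr[of n] by simp
      also have "\<dots> \<le> C * (real n * ?spex n)"
        using C(1) n turan_number_le_spectral[of n \<H>] by (intro mult_left_mono) linarith+
      finally have "real n * real n powr c \<le> real n * (C * ?spex n)" by (simp add: mult_ac)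
      then show "norm (real n powr c) \<le> C * norm (?spex n)" using n nonneg[of n] by simp
    qed
    then show ?thesis by (simp add: bigomega_iff_bigo)
  qed
  show ?thesis using upper lower omega by (auto intro: bigthetaI dest: bigthetaD1 bigthetaD2)
qed

end
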